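(* Let $q\in\mathbb{N}$, let $T$ be a $(q+1)$-homogeneous tree rooted at $o$, let $1\le p<\infty$, and let $\phi\in\operatorname{Aut}(T)$. Consider the composition operator $C_\phi$ on $\mathbb{T}_p$. Then: (i) $\|C_\phi\|=1$ if $\phi(o)=o$; (ii) $\|C_\phi\|^p=(q+1)q^{|\phi(o)|-1}$ if $\phi(o)\ne o$. In particular, every $\phi\in\operatorname{Aut}(T)$ induces a bounded composition operator $C_\phi$ on $\mathbb{T}_p$.
   Context: $\mathbb{N}=\{1,2,\ldots\}$, $\mathbb{N}_0=\mathbb{N}\cup\{0\}$. A $(q+1)$-homogeneous tree is an (infinite) connected graph without cycles in which every vertex has exactly $q+1$ neighbours; it is rooted at a fixed vertex $o$. We identify $T$ with its vertex set, write $v\sim w$ if $v,w$ are neighbours, and $|v|$ denotes the number of edges in the unique path from $o$ to $v$. An automorphism of $T$ (written $\phi\in\operatorname{Aut}(T)$) is a bijection $\phi:T\to T$ of the vertices such that $v\sim w$ if and only if $\phi(v)\sim\phi(w)$; it is not required to fix the root. For $f:T\to\mathbb{C}$ put $M_p(0,f)=|f(o)|$ and, for $n\in\mathbb{N}$, $M_p(n,f)=\left(\frac{1}{(q+1)q^{n-1}}\sum_{|v|=n}|f(v)|^p\right)^{1/p}$. Let $\|f\|_p=\sup_{n\in\mathbb{N}_0}M_p(n,f)$ and $\mathbb{T}_p=\{f:T\to\mathbb{C} : \|f\|_p<\infty\}$. The composition operator is $C_\phi f=f\circ\phi$. Its operator norm is $\|C_\phi\|=\sup\{\|f\circ\phi\|_p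 : \|f\|_p=1\}$, and $C_\phi$ is bounded on $\mathbb{T}_p$ if it maps $\mathbb{T}_p$ into itself and $\|C_\phi\|<\infty$. *)

theory Defs
  imports "HOL-Analysis.Analysis"
begin

text \<open>
  Graphs are given by an adjacency relation on a type, so the vertex set is the whole type.
  Paths and cycles are lists of vertices.
\<close>

definition simple_graph :: "('v \<Rightarrow> 'v \<Rightarrow> bool) \<Rightarrow> bool" where
  "simple_graph adj \<longleftrightarrow> symp adj \<and> irreflp adj"

definition is_path :: "('v \<Rightarrow> 'v \<Rightarrow> bool) \<Rightarrow> 'v \<Rightarrow> 'v list \<Rightarrow> 'v \<Rightarrow> bool" where
  "is_path adj u xs v \<longleftrightarrow>
     xs \<noteq> [] \<and> hd xs = u \<and> last xs = v \<and> distinct xs \<and> successively adj xs"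

definition is_cycle :: "('v \<Rightarrow> 'v \<Rightarrow> bool) \<Rightarrow> 'v list \<Rightarrow> bool" where
  "is_cycle adj xs \<longleftrightarrow>
     length xs \<ge> 3 \<and> distinct xs \<and> successively adj xs \<and> adj (last xs) (hd xs)"

definition is_tree :: "('v \<Rightarrow> 'v \<Rightarrow> bool) \<Rightarrow> bool" where
  "is_tree adj \<longleftrightarrow>
     simple_graph adj \<and> (\<forall>u v. \<exists>xs. is_path adj u xs v) \<and> (\<nexists>xs. is_cycle adj xs)"

text \<open>
  The parameter \<open>d\<close> is the number of neighbours. A set with positive \<^const>\<open>card\<close> is finite, so for
  \<open>d > 0\<close> the tree is locally finite; for \<open>d \<ge> 2\<close> it is automatically infinite.
\<close>

definition homogeneous_tree :: "nat \<Rightarrow> ('v \<Rightarrow> 'v \<Rightarrow> bool) \<Rightarrow> bool" where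
  "homogeneous_tree d adj \<longleftrightarrow> is_tree adj \<and> (\<forall>v. card {w. adj v w} = d)"

definition tree_aut :: "('v \<Rightarrow> 'v \<Rightarrow> bool) \<Rightarrow> ('v \<Rightarrow> 'v) set" where
  "tree_aut adj = {\<phi>. bij \<phi> \<and> (\<forall>v w. adj v w \<longleftrightarrow> adj (\<phi> v) (\<phi> w))}"

text \<open>The number of edges of a path is one less than its number of vertices.\<close>

definition level :: "('v \<Rightarrow> 'v \<Rightarrow> bool) \<Rightarrow> 'v \<Rightarrow> 'v \<Rightarrow> nat" where
  "level adj r v = length (THE xs. is_path adj r xs v) - 1"

definition Mp :: "nat \<Rightarrow> ('v \<Rightarrow> 'v \<Rightarrow> bool) \<Rightarrow> 'v \<Rightarrow> real \<Rightarrow> nat \<Rightarrow> ('v \<Rightarrow> complex) \<Rightarrow> real" where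
  "Mp q adj r p n f =
     (if n = 0 then cmod (f r)
      else ((1 / ((real q + 1) * real q ^ (n - 1))) *
            (\<Sum>v | level adj r v = n. cmod (f v) powr p)) powr (1 / p))"

text \<open>The supremum may be infinite, hence norms take values in \<^typ>\<open>ennreal\<close>.\<close>

definition Tp_norm :: "nat \<Rightarrow> ('v \<Rightarrow> 'v \<Rightarrow> bool) \<Rightarrow> 'v \<Rightarrow> real \<Rightarrow> ('v \<Rightarrow> complex) \<Rightarrow> ennreal" where
  "Tp_norm q adj r p f = (SUP n. ennreal (Mp q adj r p n f))"

definition Tp_space :: "nat \<Rightarrow> ('v \<Rightarrow> 'v \<Rightarrow> bool) \<Rightarrow> 'v \<Rightarrow> real \<Rightarrow> ('v \<Rightarrow> complex) set" where
  "Tp_space q adj r p = {f. Tp_norm q adj r p f < \<infinity>}"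

definition comp_op :: "('v \<Rightarrow> 'v) \<Rightarrow> ('v \<Rightarrow> complex) \<Rightarrow> ('v \<Rightarrow> complex)" where
  "comp_op \<phi> f = f \<circ> \<phi>"

definition op_norm ::
  "nat \<Rightarrow> ('v \<Rightarrow> 'v \<Rightarrow> bool) \<Rightarrow> 'v \<Rightarrow> real \<Rightarrow> (('v \<Rightarrow> complex) \<Rightarrow> ('v \<Rightarrow> complex)) \<Rightarrow> ennreal" where
  "op_norm q adj r p A = (SUP f\<in>{f. Tp_norm q adj r p f = 1}. Tp_norm q adj r p (A f))"

definition bounded_op ::
  "nat \<Rightarrow> ('v \<Rightarrow> 'v \<Rightarrow> bool) \<Rightarrow> 'v \<Rightarrow> real \<Rightarrow> (('v \<Rightarrow> complex) \<Rightarrow> ('v \<Rightarrow> complex)) \<Rightarrow> bool" where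
  "bounded_op q adj r p A \<longleftrightarrow>
     A ` Tp_space q adj r p \<subseteq> Tp_space q adj r p \<and> op_norm q adj r p A < \<infinity>"

end

theory Submission
  imports Defs
begin

text \<open>
  Put \<open>a = \<phi> r\<close>, let \<open>m\<close> be its level, and let \<open>c n\<close> be the number of vertices at level \<open>n\<close>.
  The \<open>n\<close>-th mean of \<open>f \<circ> \<phi>\<close> is the mean of \<open>f\<close> over the sphere of radius \<open>n\<close> around \<open>a\<close>. As levels
  change by exactly one along an edge, this sphere only meets the levels \<open>n + m - 2 j\<close>, and
  \<open>c (n + m) + c (n + m - 2) + \<dots> \<le> c n * c m\<close> if \<open>q \<ge> 2\<close>; this gives the upper bound.
  For \<open>q = 1\<close> the sphere has at most two points and each contributes at most \<open>c k \<le> 2\<close>.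
  The bound is attained, in the \<open>0\<close>-th mean, by a multiple of the indicator function of \<open>a\<close>.
\<close>

section \<open>Paths and cycles\<close>

lemma is_path_singleton [simp]: "is_path adj u [x] v \<longleftrightarrow> x = u \<and> x = v"
  by (auto simp: is_path_def)

lemma is_path_Cons:
  "xs \<noteq> [] \<Longrightarrow> is_path adj u (x # xs) v \<longleftrightarrow>
     x = u \<and> adj u (hd xs) \<and> u \<notin> set xs \<and> is_path adj (hd xs) xs v"
  by (auto simp: is_path_def successively_Cons)

text \<open>Follow the first path up to the first vertex \<open>z\<close> that also lies on the
  second, then return to \<open>u\<close> along the second path backwards.\<close>

lemma two_paths_cycle:
  assumes sym: "symp adj"
    and xs: "is_path adj u (u # xs) v" "xs \<noteq> []"
    and ys: "is_path adj u (u # ys) v" "ys \<noteq> []"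
    and ne: "hd xs \<noteq> hd ys"
  shows "\<exists>cs. is_cycle adj cs"
proof -
  have "\<exists>z\<in>set xs. z \<in> set ys"
    using xs ys by (metis is_path_def last_ConsR last_in_set)
  then obtain A z B where xs_eq: "xs = A @ z # B" and z: "z \<in> set ys"
    and A: "\<forall>x\<in>set A. x \<notin> set ys"
    using split_list_first_prop[of xs "\<lambda>x. x \<in> set ys"] by blast
  obtain C D where ys_eq: "ys = C @ z # D"
    using z by (meson split_list)
  let ?cs = "u # A @ z # rev C"
  \<comment> \<open>Otherwise both tails would begin with \<open>z\<close>. This supplies the third
    vertex of the cycle.\<close>
  have "A \<noteq> [] \<or> C \<noteq> []"
    using ne xs_eq ys_eq by auto
  then have len: "length ?cs \<ge> 3"
    by (cases A; cases C) auto
  have dist: "distinct ?cs"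
    using xs(1) ys(1) A unfolding xs_eq ys_eq is_path_def by auto
  have "successively adj ((u # A @ [z]) @ B)"
    using xs(1) by (simp add: is_path_def xs_eq)
  then have "successively adj (u # A @ [z])"
    unfolding successively_append_iff by simp
  then have s1: "successively adj ((u # A) @ [z])"
    by simp
  have "successively adj ((u # C @ [z]) @ D)"
    using ys(1) by (simp add: is_path_def ys_eq)
  then have s2: "successively adj (u # C @ [z])"
    unfolding successively_append_iff by simp
  have "(\<lambda>x y. adj y x) = adj"
    using sym by (auto simp: fun_eq_iff dest: sympD)
  with s2 have "successively adj (rev (u # C @ [z]))"
    by (simp only: successively_rev)
  then have s3: "successively adj ((z # rev C) @ [u])"
    by simp
  have "successively adj ((u # A) @ z # rev C)"
    using s1 s3 unfolding successively_append_iff by simp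
  then have "successively adj ?cs"
    by simp
  moreover have "adj (last ?cs) (hd ?cs)"
    using s3 unfolding successively_append_iff by simp
  ultimately show ?thesis
    using len dist unfolding is_cycle_def by blast
qed

section \<open>Sphere sizes and their sums\<close>

text \<open>These are the denominators in \<open>Mp\<close>, extended by 1 at level 0. The extension
  lets the cases \<open>n = 0\<close> and \<open>n > 0\<close>, and later \<phi> fixing or moving
  the root, be treated together.\<close>

definition sphere_size :: "nat \<Rightarrow> nat \<Rightarrow> nat" where
  "sphere_size q n = (if n = 0 then 1 else (q + 1) * q ^ (n - 1))"

lemma sphere_size_0 [simp]: "sphere_size q 0 = 1"
  and sphere_size_Suc [simp]: "sphere_size q (Suc n) = (q + 1) * q ^ n"
  by (simp_all add: sphere_size_def)

lemma sphere_size_pos: "q \<ge> 1 \<Longrightarrow> sphere_size q n > 0"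
  by (simp add: sphere_size_def)

text \<open>For positive \<open>n\<close> and \<open>m\<close> the product of the two sphere sizes
  depends only on \<open>n + m\<close>, here \<open>N + 2\<close>. Induction in steps of two splits
  off the top term. For \<open>q = 1\<close> the left side grows with \<open>N\<close> while the
  right side stays 4.\<close>

lemma sum_sphere_size_le_aux:
  assumes "q \<ge> 2"
  shows "(\<Sum>j\<le>(N + 2) div 2. sphere_size q (N + 2 - 2 * j)) \<le> (q + 1)\<^sup>2 * q ^ N"
proof (induction N rule: nat_less_induct)
  case (1 N)
  consider "N = 0" | "N = 1" | M where "N = M + 2"
    by (metis One_nat_def add.commute add_2_eq_Suc not0_implies_Suc)
  then show ?case
  proof cases
    case 1
    then show ?thesis
      by (simp add: sphere_size_def power2_eq_square algebra_simps)
  next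
    case 2
    have "(q + 1) * (q\<^sup>2 + 1) \<le> (q + 1) * (q\<^sup>2 + q)"
      using assms by (intro mult_left_mono) auto
    then show ?thesis
      using 2 by (simp add: sphere_size_def power2_eq_square algebra_simps)
  next
    case 3
    \<comment> \<open>After splitting off the top term, the inequality left to prove reduces to
      \<open>q + 1\<close> \<le> \<open>q * q\<close>.\<close>
    have "Suc q \<le> 2 * q" "2 * q \<le> q * q"
      using assms by auto
    then have "q + 1 \<le> q\<^sup>2"
      unfolding power2_eq_square by linarith
    then have q: "q ^ M * (q + 1) * (q + 1) \<le> q ^ M * q\<^sup>2 * (q + 1)"
      by (intro mult_mono) auto
    have "(\<Sum>j\<le>(N + 2) div 2. sphere_size q (N + 2 - 2 * j)) =
        sphere_size q (N + 2) + (\<Sum>j\<le>(M + 2) div 2. sphere_size q (M + 2 - 2 * j))"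
      using 3 by (simp add: sum.atMost_Suc_shift del: sum.atMost_Suc)
    also have "\<dots> \<le> sphere_size q (N + 2) + (q + 1)\<^sup>2 * q ^ M"
      using "1" 3 by simp
    also have "\<dots> \<le> (q + 1)\<^sup>2 * q ^ N"
      using q 3 by (simp add: power2_eq_square power_add algebra_simps)
    finally show ?thesis .
  qed
qed

lemma sum_sphere_size_le:
  assumes "q \<ge> 2" "n > 0" "m > 0"
  shows "(\<Sum>j\<le>(n + m) div 2. sphere_size q (n + m - 2 * j)) \<le> sphere_size q n * sphere_size q m"
proof -
  obtain n' m' where "n = Suc n'" "m = Suc m'"
    using assms by (meson gr0_implies_Suc)
  then show ?thesis
    using sum_sphere_size_le_aux[OF assms(1), of "n' + m'"]
    by (simp add: power2_eq_square power_add algebra_simps)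
qed

section \<open>Levels in a tree\<close>

context
  fixes adj :: "'v \<Rightarrow> 'v \<Rightarrow> bool"
  assumes tree: "is_tree adj"
begin

lemma adj_sym: "adj u v \<Longrightarrow> adj v u"
  using tree by (auto simp: is_tree_def simple_graph_def dest: sympD)

lemma adj_irrefl [simp]: "\<not> adj u u"
  using tree by (auto simp: is_tree_def simple_graph_def irreflp_def)

lemma path_exists: "\<exists>xs. is_path adj u xs v"
  using tree by (auto simp: is_tree_def)

text \<open>Two different second vertices would produce a cycle, so the paths agree step by step.
  This makes the \<open>THE\<close> in \<open>level\<close> meaningful.\<close>

lemma path_unique: "is_path adj u xs v \<Longrightarrow> is_path adj u ys v \<Longrightarrow> xs = ys"
proof (induction xs arbitrary: u ys)
  case Nil
  then show ?case by (simp add: is_path_def)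
next
  case (Cons x xs)
  obtain y ys' where ys: "ys = y # ys'"
    using Cons.prems(2) by (cases ys) (auto simp: is_path_def)
  have xy: "x = u" "y = u"
    using Cons.prems ys by (auto simp: is_path_def)
  show ?case
  proof (cases "xs = [] \<or> ys' = []")
    case True
    then show ?thesis
      using Cons.prems ys by (auto simp: is_path_def split: if_splits)
  next
    case False
    have "hd xs = hd ys'"
      using two_paths_cycle[of adj u xs v ys'] Cons.prems xy ys False tree
      by (auto simp: is_tree_def simple_graph_def)
    then show ?thesis
      using Cons.IH[of "hd xs" ys'] Cons.prems xy ys False by (auto simp: is_path_Cons)
  qed
qed

lemma level_eq: "is_path adj u xs v \<Longrightarrow> level adj u v = length xs - 1"
  unfolding level_def by (metis path_unique the_equality)

lemma level_self [simp]: "level adj u u = 0"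
  by (subst level_eq[of u "[u]"]) auto

lemma level_eq_0_iff [simp]: "level adj u v = 0 \<longleftrightarrow> u = v"
proof
  assume 0: "level adj u v = 0"
  obtain xs where xs: "is_path adj u xs v"
    using path_exists by blast
  then have "length xs = 1"
    using 0 level_eq[OF xs] by (cases xs) (auto simp: is_path_def)
  then show "u = v"
    using xs by (auto simp: length_Suc_conv)
qed auto

text \<open>If \<open>w\<close> is off the path to \<open>v\<close>, appending it gives the path to
  \<open>w\<close>. If \<open>w\<close> is on it, the remainder from \<open>w\<close> to
  \<open>v\<close> is the single edge, by uniqueness of paths.\<close>

lemma level_adj:
  assumes "adj v w"
  shows "level adj u w = Suc (level adj u v) \<or> level adj u v = Suc (level adj u w)"
proof -
  obtain xs where xs: "is_path adj u xs v"
    using path_exists by blast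
  then have ne: "xs \<noteq> []"
    by (simp add: is_path_def)
  have vw: "v \<noteq> w"
    using assms by auto
  show ?thesis
  proof (cases "w \<in> set xs")
    case False
    then have "is_path adj u (xs @ [w]) w"
      using xs assms by (auto simp: is_path_def successively_append_iff)
    then show ?thesis
      using level_eq xs ne by (cases xs) fastforce+
  next
    case True
    then obtain A B where AB: "xs = A @ w # B"
      by (meson split_list)
    have p1: "is_path adj u (A @ [w]) w"
      using xs unfolding AB is_path_def
      by (auto simp: successively_append_iff successively_Cons hd_append split: if_splits)
    have "is_path adj w (w # B) v"
      using xs unfolding AB is_path_def by (auto simp: successively_append_iff)
    moreover have "is_path adj w [w, v] v"
      using vw adj_sym[OF assms] by (auto simp: is_path_def)
    ultimately have "w # B = [w, v]"
      by (rule path_unique)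
    then show ?thesis
      using level_eq[OF p1] level_eq[OF xs] AB by simp
  qed
qed

text \<open>The parent \<open>w\<close> is the second to last vertex of the path from
  \<open>u\<close> to \<open>v\<close>.\<close>

lemma level_pred:
  assumes "level adj u v = Suc n"
  shows "\<exists>w. adj w v \<and> level adj u w = n"
proof -
  obtain xs where xs: "is_path adj u xs v"
    using path_exists by blast
  then have len: "length xs = Suc (Suc n)"
    using assms level_eq[OF xs] by (cases xs) (auto simp: is_path_def)
  then obtain ws z where "xs = ws @ [z]" "length ws = Suc n"
    by (metis append_butlast_last_id diff_Suc_1 length_butlast list.size(3) nat.distinct(1))
  then obtain ys y where eq: "xs = (ys @ [y]) @ [z]"
    by (metis append_butlast_last_id list.size(3) nat.distinct(1))
  have "successively adj ((ys @ [y]) @ [z])" and z: "z = v"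
    and hd_eq: "hd ((ys @ [y]) @ [z]) = u" and dist: "distinct (ys @ [y])"
    using xs by (auto simp: is_path_def eq)
  then have "successively adj (ys @ [y])" "adj y v"
    unfolding successively_append_iff[of adj "ys @ [y]"] by simp_all
  moreover have "hd (ys @ [y]) = u"
    using hd_eq by (subst (asm) hd_append2) auto
  ultimately have "is_path adj u (ys @ [y]) y" "adj y v"
    using dist by (simp_all add: is_path_def)
  then show ?thesis
    using level_eq[of u "ys @ [y]" y] len eq by auto
qed

text \<open>The witness \<open>j\<close> counts the edges along which the level drops. Writing
  \<open>2 * j\<close> on the left avoids truncated subtraction.\<close>

lemma level_last_walk:
  "successively adj xs \<Longrightarrow> xs \<noteq> [] \<Longrightarrow>
     \<exists>j. level adj u (last xs) + 2 * j = level adj u (hd xs) + (length xs - 1)"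
proof (induction xs)
  case (Cons x xs)
  show ?case
  proof (cases "xs = []")
    case False
    then have x: "adj x (hd xs)" and "successively adj xs"
      using Cons.prems by (auto simp: successively_Cons)
    then obtain j where
      j: "level adj u (last xs) + 2 * j = level adj u (hd xs) + (length xs - 1)"
      using Cons.IH False by blast
    have "length xs > 0"
      using False by simp
    \<comment> \<open>The first case is an edge leading up, the second an edge leading down, which
      raises the count by one.\<close>
    with j level_adj[OF x, of u] consider
      "level adj u (last xs) + 2 * j = level adj u x + length xs" |
      "level adj u (last xs) + 2 * Suc j = level adj u x + length xs"
      by fastforce
    then show ?thesis
      using False by cases (auto intro: exI[of _ j] exI[of _ "Suc j"])
  qed auto
qed simp

lemma level_parity: "\<exists>j. level adj u v + 2 * j = level adj u w + level adj w v"
proof -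
  obtain xs where xs: "is_path adj w xs v"
    using path_exists by blast
  then show ?thesis
    using level_last_walk[of xs u] level_eq[OF xs] by (auto simp: is_path_def)
qed

text \<open>The image of a path is a path of the same length. The base point moves along with the
  vertex, since \<phi> may move the root.\<close>

lemma level_aut:
  assumes "\<phi> \<in> tree_aut adj"
  shows "level adj (\<phi> u) (\<phi> v) = level adj u v"
proof -
  obtain xs where xs: "is_path adj u xs v"
    using path_exists by blast
  then have "is_path adj (\<phi> u) (map \<phi> xs) (\<phi> v)"
    using assms unfolding is_path_def tree_aut_def
    by (auto simp: hd_map last_map distinct_map successively_map bij_def
        elim: inj_on_subset)
  then show ?thesis
    using level_eq[OF xs] level_eq by fastforce
qed

end

section \<open>Spheres in a homogeneous tree\<close>

text \<open>Every vertex of level \<open>n + 1\<close> has a parent of level \<open>n\<close>, so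
  counting children bounds the sphere. Finiteness is used throughout; the bound on the cardinality
  serves the case \<open>q = 1\<close> of \<open>sphere_sum_bound\<close>.\<close>

lemma homogeneous_sphere:
  assumes "homogeneous_tree (q + 1) adj"
  shows "finite {v. level adj u v = n} \<and> card {v. level adj u v = n} \<le> sphere_size q n"
proof (induction n)
  case 0
  have "{v. level adj u v = 0} = {u}"
    using assms by (auto simp: homogeneous_tree_def)
  then show ?case by simp
next
  case (Suc n)
  have tree: "is_tree adj" and deg: "card {w. adj v w} = q + 1" for v
    using assms by (auto simp: homogeneous_tree_def)
  have fin: "finite {w. adj v w}" for v
    using deg[of v] by (metis add_eq_0_iff_both_eq_0 card.infinite zero_neq_one)
  let ?S = "\<lambda>n. {v. level adj u v = n}"
  let ?N = "\<lambda>w. {v. adj w v \<and> level adj u v = Suc n}"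
  have eq: "?S (Suc n) = (\<Union>w\<in>?S n. ?N w)"
    using level_pred[OF tree, of u _ n] by auto
  have finN: "finite (?N w)" for w
    by (rule finite_subset[OF _ fin[of w]]) auto
  let ?b = "if n = 0 then q + 1 else q"
  have cardN: "card (?N w) \<le> ?b" if w: "w \<in> ?S n" for w
  proof (cases n)
    case 0
    have "card (?N w) \<le> card {v. adj w v}"
      by (intro card_mono fin) auto
    then show ?thesis
      using 0 deg by simp
  next
    case (Suc k)
    then obtain x where x: "adj x w" "level adj u x = k"
      using level_pred[OF tree, of u w k] w by auto
    \<comment> \<open>The parent \<open>x\<close> lies one level below \<open>w\<close>, hence is
      not among its children.\<close>
    have "card (?N w) \<le> card ({v. adj w v} - {x})"
      using x Suc fin by (intro card_mono) auto
    also have "\<dots> = q"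
      using x adj_sym[OF tree] fin deg by (subst card_Diff_singleton) auto
    finally show ?thesis
      using Suc by simp
  qed
  have "card (?S (Suc n)) \<le> (\<Sum>w\<in>?S n. card (?N w))"
    unfolding eq using Suc.IH by (intro card_UN_le) auto
  also have "\<dots> \<le> card (?S n) * ?b"
    using cardN sum_bounded_above[of "?S n" "\<lambda>w. card (?N w)" ?b] by simp
  also have "\<dots> \<le> sphere_size q n * ?b"
    using Suc.IH by (intro mult_right_mono) auto
  also have "\<dots> = sphere_size q (Suc n)"
    by (cases n) (auto simp: algebra_simps)
  finally have "card (?S (Suc n)) \<le> sphere_size q (Suc n)" .
  moreover have "finite (?S (Suc n))"
    unfolding eq using Suc.IH finN by blast
  ultimately show ?case
    by (rule conjI[rotated])
qed

text \<open>To be applied with \<open>g v = cmod (f v) powr p\<close> and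
  \<open>B = t powr p\<close>: bounds on the spheres around \<open>r\<close> pass to those around
  \<open>a\<close> at the cost of one factor, the sphere size at the level of
  \<open>a\<close>.\<close>

lemma sphere_sum_bound:
  fixes g :: "'v \<Rightarrow> real"
  assumes q: "q \<ge> 1" and hom: "homogeneous_tree (q + 1) adj"
    and g: "\<And>v. g v \<ge> 0" and B: "B \<ge> 0"
    and le: "\<And>k. (\<Sum>v | level adj r v = k. g v) \<le> real (sphere_size q k) * B"
  shows "(\<Sum>v | level adj a v = n. g v)
           \<le> real (sphere_size q n) * real (sphere_size q (level adj r a)) * B"
proof -
  have tree: "is_tree adj"
    using hom by (simp add: homogeneous_tree_def)
  note fin = homogeneous_sphere[OF hom, THEN conjunct1]
  define m where "m = level adj r a"
  \<comment> \<open>A single value is at most the sum over the sphere around \<open>r\<close> that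
    contains it. This settles \<open>n = 0\<close> and \<open>q = 1\<close>.\<close>
  have point: "g v \<le> real (sphere_size q (level adj r v)) * B" for v
    using member_le_sum[of v "{w. level adj r w = level adj r v}" g] fin g
      le[of "level adj r v"] by fastforce
  consider "m = 0" | "n = 0" | "q = 1" "n > 0" "m > 0" | "q \<ge> 2" "n > 0" "m > 0"
    using q by linarith
  then have "(\<Sum>v | level adj a v = n. g v)
      \<le> real (sphere_size q n) * real (sphere_size q m) * B"
  proof cases
    case 1
    then show ?thesis
      using le[of n] tree by (simp add: m_def)
  next
    case 2
    have "{v. level adj a v = 0} = {a}"
      using tree by auto
    then show ?thesis
      using 2 point[of a] by (simp add: m_def)
  next
    case 3
    \<comment> \<open>As \<open>n\<close> and \<open>m\<close> are positive, both sphere sizes in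
      the claim equal 2. At most two points with values at most \<open>2 * B\<close> therefore
      suffice.\<close>
    have c: "sphere_size q k \<le> 2" for k
      using 3 by (simp add: sphere_size_def)
    have "g v \<le> 2 * B" for v
      using point[of v] c[of "level adj r v"] B
      by (meson mult_right_mono of_nat_le_numeral_iff order_trans)
    then have "(\<Sum>v | level adj a v = n. g v) \<le> real (card {v. level adj a v = n}) * (2 * B)"
      by (intro sum_bounded_above)
    also have "\<dots> \<le> real (sphere_size q n) * (2 * B)"
      using homogeneous_sphere[OF hom, of a n] B by (intro mult_right_mono) auto
    finally show ?thesis
      using 3 by (simp add: sphere_size_def)
  next
    case 4
    \<comment> \<open>Within this range \<open>n + m - 2 * j\<close> is never truncated, so
      different \<open>j\<close> give disjoint sets \<open>?T j\<close>.\<close>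
    let ?J = "{..(n + m) div 2}"
    let ?T = "\<lambda>j. {v. level adj r v = n + m - 2 * j}"
    have sub: "{v. level adj a v = n} \<subseteq> (\<Union>j\<in>?J. ?T j)"
    proof
      fix v assume v: "v \<in> {v. level adj a v = n}"
      obtain j where "level adj r v + 2 * j = m + n"
        using level_parity[OF tree, of r v a] v by (auto simp: m_def)
      then have "j \<in> ?J" "v \<in> ?T j"
        by auto
      then show "v \<in> (\<Union>j\<in>?J. ?T j)"
        by blast
    qed
    have "(\<Sum>v | level adj a v = n. g v) \<le> (\<Sum>v\<in>(\<Union>j\<in>?J. ?T j). g v)"
      using fin g sub by (intro sum_mono2) auto
    also have "\<dots> = (\<Sum>j\<in>?J. \<Sum>v\<in>?T j. g v)"
      using fin by (intro sum.UNION_disjoint) auto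
    also have "\<dots> \<le> (\<Sum>j\<in>?J. real (sphere_size q (n + m - 2 * j)) * B)"
      by (intro sum_mono le)
    also have "\<dots> = real (\<Sum>j\<in>?J. sphere_size q (n + m - 2 * j)) * B"
      by (simp add: sum_distrib_right)
    also have "\<dots> \<le> real (sphere_size q n * sphere_size q m) * B"
      using sum_sphere_size_le[OF 4] B by (intro mult_right_mono of_nat_mono) auto
    finally show ?thesis
      by simp
  qed
  then show ?thesis
    by (simp add: m_def)
qed

section \<open>Means and norms\<close>

lemma Mp_eq:
  assumes "is_tree adj" "p > 0"
  shows "Mp q adj r p n f =
    ((\<Sum>v | level adj r v = n. cmod (f v) powr p) / real (sphere_size q n)) powr (1 / p)"
proof (cases n)
  case 0
  have "{v. level adj r v = 0} = {r}"
    using assms(1) by auto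
  then show ?thesis
    using 0 assms(2) by (simp add: Mp_def powr_powr)
next
  case (Suc k)
  have "real (sphere_size q (Suc k)) = (real q + 1) * real q ^ k"
    by (simp add: algebra_simps)
  then show ?thesis
    using Suc by (simp add: Mp_def del: sphere_size_Suc)
qed

text \<open>Taking the power \<open>1 / p\<close> is strictly increasing on nonnegative reals.
  Removing it turns norm bounds into bounds on plain sums.\<close>

lemma Mp_le_iff:
  assumes "is_tree adj" "p > 0" "q \<ge> 1" "t \<ge> 0"
  shows "Mp q adj r p n f \<le> t \<longleftrightarrow>
    (\<Sum>v | level adj r v = n. cmod (f v) powr p) \<le> real (sphere_size q n) * t powr p"
proof -
  let ?S = "\<Sum>v | level adj r v = n. cmod (f v) powr p"
  let ?c = "real (sphere_size q n)"
  have c: "?c > 0"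
    using sphere_size_pos[OF assms(3)] by simp
  have S: "?S \<ge> 0"
    by (intro sum_nonneg) auto
  have x: "?S / ?c \<ge> 0" and p': "1 / p > 0"
    using S c assms(2) by simp_all
  have "t = (t powr p) powr (1 / p)"
    using assms by (simp add: powr_powr)
  then have "Mp q adj r p n f \<le> t \<longleftrightarrow> (?S / ?c) powr (1 / p) \<le> (t powr p) powr (1 / p)"
    using Mp_eq[OF assms(1,2)] by metis
  also have "\<dots> \<longleftrightarrow> ?S / ?c \<le> t powr p"
    using powr_mono2[OF _ x, of "1 / p" "t powr p"] powr_less_mono2[OF p' powr_ge_zero] p'
    by (meson less_imp_le not_le)
  also have "\<dots> \<longleftrightarrow> ?S \<le> ?c * t powr p"
    using c by (simp add: field_simps)
  finally show ?thesis .
qed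

lemma Tp_norm_le_iff:
  assumes "is_tree adj" "p > 0" "q \<ge> 1" "t \<ge> 0"
  shows "Tp_norm q adj r p f \<le> ennreal t \<longleftrightarrow>
    (\<forall>n. (\<Sum>v | level adj r v = n. cmod (f v) powr p) \<le> real (sphere_size q n) * t powr p)"
  using Mp_le_iff[OF assms] assms(4) by (simp add: Tp_norm_def SUP_le_iff)

section \<open>The norm of the composition operator\<close>

text \<open>\<phi> carries the sphere around \<open>r\<close> onto the sphere of the same radius
  around \<open>\<phi> r\<close>, so the sum can be reindexed. The free bound \<open>t\<close>
  serves both the operator norm (\<open>t = 1\<close>) and the invariance of
  \<open>Tp_space\<close>.\<close>

lemma Tp_norm_comp_le:
  assumes q: "q \<ge> 1" and hom: "homogeneous_tree (q + 1) adj" and p: "p > 0"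
    and \<phi>: "\<phi> \<in> tree_aut adj" and t: "t \<ge> 0" and f: "Tp_norm q adj r p f \<le> ennreal t"
  shows "Tp_norm q adj r p (comp_op \<phi> f)
    \<le> ennreal (real (sphere_size q (level adj r (\<phi> r))) powr (1 / p) * t)"
proof -
  have tree: "is_tree adj"
    using hom by (simp add: homogeneous_tree_def)
  let ?c = "real (sphere_size q (level adj r (\<phi> r)))"
  have "(\<Sum>v | level adj r v = n. cmod (comp_op \<phi> f v) powr p)
      \<le> real (sphere_size q n) * (?c powr (1 / p) * t) powr p" for n
  proof -
    have bij: "bij \<phi>"
      using \<phi> by (simp add: tree_aut_def)
    have "{v. level adj (\<phi> r) v = n} = \<phi> ` {v. level adj r v = n}"
      using bij level_aut[OF tree \<phi>, of r] by (force simp: bij_def surj_def)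
    then have "bij_betw \<phi> {v. level adj r v = n} {v. level adj (\<phi> r) v = n}"
      using bij by (auto simp: bij_betw_def elim: inj_on_subset)
    then have "(\<Sum>v | level adj r v = n. cmod (comp_op \<phi> f v) powr p)
        = (\<Sum>v | level adj (\<phi> r) v = n. cmod (f v) powr p)"
      by (simp add: comp_op_def sum.reindex_bij_betw[symmetric])
    also have "\<dots> \<le> real (sphere_size q n) * ?c * t powr p"
      using f Tp_norm_le_iff[OF tree p q t]
      by (intro sphere_sum_bound[OF q hom]) auto
    also have "\<dots> = real (sphere_size q n) * (?c powr (1 / p) * t) powr p"
      using p t by (simp add: powr_mult powr_powr)
    finally show ?thesis .
  qed
  then show ?thesis
    using Tp_norm_le_iff[OF tree p q] t by simp
qed

lemma Mp_point_mass:
  assumes "is_tree adj" "p > 0" "b \<ge> 0" "finite {v. level adj r v = n}"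
  shows "Mp q adj r p n (\<lambda>v. if v = a then of_real b else 0) =
    (if level adj r a = n then b / real (sphere_size q n) powr (1 / p) else 0)"
proof -
  have "(\<Sum>v | level adj r v = n. cmod (if v = a then of_real b else 0) powr p)
      = (\<Sum>v | level adj r v = n. if v = a then b powr p else 0)"
    using assms(3) by (intro sum.cong) auto
  also have "\<dots> = (if level adj r a = n then b powr p else 0)"
    using assms(4) by simp
  finally show ?thesis
    using assms by (simp add: Mp_eq powr_divide powr_powr)
qed

lemma op_norm_comp_op:
  assumes q: "q \<ge> 1" and hom: "homogeneous_tree (q + 1) adj" and p: "p > 0"
    and \<phi>: "\<phi> \<in> tree_aut adj"
  shows "op_norm q adj r p (comp_op \<phi>)
    = ennreal (real (sphere_size q (level adj r (\<phi> r))) powr (1 / p))"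
    (is "_ = ennreal ?C")
proof (rule antisym)
  show "op_norm q adj r p (comp_op \<phi>) \<le> ennreal ?C"
    unfolding op_norm_def
    using Tp_norm_comp_le[OF q hom p \<phi>, of 1 r] by (auto intro!: SUP_least)
next
  have tree: "is_tree adj"
    using hom by (simp add: homogeneous_tree_def)
  \<comment> \<open>The height \<open>?C\<close> cancels the normalisation at the level of
    \<open>\<phi> r\<close>, so the only nonzero mean of \<open>f\<close> is 1.\<close>
  define f :: "'a \<Rightarrow> complex" where "f = (\<lambda>v. if v = \<phi> r then of_real ?C else 0)"
  have C: "?C > 0"
    using sphere_size_pos[OF q] by (metis less_irrefl of_nat_0_less_iff powr_gt_zero)
  have M: "Mp q adj r p n f = (if level adj r (\<phi> r) = n then 1 else 0)" for n
    using Mp_point_mass[OF tree p, of ?C r n q "\<phi> r"] homogeneous_sphere[OF hom, of r n] C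
    by (auto simp: f_def)
  have norm: "Tp_norm q adj r p f = 1"
    unfolding Tp_norm_def
  proof (rule antisym)
    show "(SUP n. ennreal (Mp q adj r p n f)) \<le> 1"
      by (rule SUP_least) (simp add: M)
    show "1 \<le> (SUP n. ennreal (Mp q adj r p n f))"
      by (rule SUP_upper2[of "level adj r (\<phi> r)"]) (simp_all add: M)
  qed
  \<comment> \<open>Composition moves the mass to the root, where the mean has no denominator and
    shows the full height.\<close>
  have "ennreal ?C = ennreal (Mp q adj r p 0 (comp_op \<phi> f))"
    using C by (simp add: Mp_def comp_op_def f_def)
  also have "\<dots> \<le> Tp_norm q adj r p (comp_op \<phi> f)"
    unfolding Tp_norm_def by (rule SUP_upper) simp
  also have "\<dots> \<le> op_norm q adj r p (comp_op \<phi>)"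
    unfolding op_norm_def using norm by (intro SUP_upper) simp
  finally show "ennreal ?C \<le> op_norm q adj r p (comp_op \<phi>)" .
qed

theorem theorem5:
  fixes q :: nat and adj :: "'v \<Rightarrow> 'v \<Rightarrow> bool" and r :: 'v and p :: real and \<phi> :: "'v \<Rightarrow> 'v"
  assumes "q \<ge> 1"
    and "homogeneous_tree (q + 1) adj"
    and "1 \<le> p"
    and "\<phi> \<in> tree_aut adj"
  shows "(\<phi> r = r \<longrightarrow> op_norm q adj r p (comp_op \<phi>) = 1) \<and>
         (\<phi> r \<noteq> r \<longrightarrow>
            op_norm q adj r p (comp_op \<phi>) < \<infinity> \<and>
            enn2real (op_norm q adj r p (comp_op \<phi>)) powr p
              = (real q + 1) * real q ^ (level adj r (\<phi> r) - 1)) \<and>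
         bounded_op q adj r p (comp_op \<phi>)"
proof -
  have p: "p > 0" and tree: "is_tree adj"
    using assms by (auto simp: homogeneous_tree_def)
  note norm = op_norm_comp_op[OF assms(1,2) p assms(4), of r]
  have "comp_op \<phi> f \<in> Tp_space q adj r p" if f: "f \<in> Tp_space q adj r p" for f
  proof -
    obtain t where "t \<ge> 0" "Tp_norm q adj r p f = ennreal t"
      using f by (cases "Tp_norm q adj r p f") (auto simp: Tp_space_def)
    then have "Tp_norm q adj r p (comp_op \<phi> f)
        \<le> ennreal (real (sphere_size q (level adj r (\<phi> r))) powr (1 / p) * t)"
      using Tp_norm_comp_le[OF assms(1,2) p assms(4), of t r f] by simp
    also have "\<dots> < \<infinity>"
      by simp
    finally show ?thesis
      by (simp add: Tp_space_def)
  qed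
  then have "bounded_op q adj r p (comp_op \<phi>)"
    using norm by (auto simp: bounded_op_def)
  \<comment> \<open>Here the level of \<open>\<phi> r\<close> is 0 and the sphere size is 1.\<close>
  moreover have "op_norm q adj r p (comp_op \<phi>) = 1" if "\<phi> r = r"
    using norm that tree by simp
  moreover have "enn2real (op_norm q adj r p (comp_op \<phi>)) powr p
      = (real q + 1) * real q ^ (level adj r (\<phi> r) - 1)" if "\<phi> r \<noteq> r"
  proof -
    \<comment> \<open>A nonzero level selects the second branch of
      \<open>sphere_size\<close>.\<close>
    have "level adj r (\<phi> r) \<noteq> 0"
      using that tree by simp
    then have "real (sphere_size q (level adj r (\<phi> r)))
        = (real q + 1) * real q ^ (level adj r (\<phi> r) - 1)"
      by (simp add: sphere_size_def algebra_simps)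
    then show ?thesis
      using norm p by (simp add: powr_powr)
  qed
  ultimately show ?thesis
    using norm by simp
qed

end
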